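(* Let $\mathcal{E}$ be the elliptic curve over $\mathbb{Q}$ defined in $\mathbb{P}^2$ with homogeneous coordinates $(a:b:c)$ by $$q(a,b,c) = -c^3 - c^2(a+b) + c(a^2+ab+b^2) + (a^3+a^2b+ab^2+b^3)=0,$$ with identity element $O=(1:-1:0)$. Then $\mathcal{E}$ has infinitely many rational points. In particular, the point $A=(1:0:-1)$ has infinite order in $\mathcal{E}(\mathbb{Q})$.
   Context: The curve $\mathcal{E}$ is a smooth plane cubic, and $O=(1:-1:0)$ is an inflexion point of it; the group law on $\mathcal{E}(\mathbb{Q})$ is the usual chord-and-tangent law with identity $O$, so that three points of $\mathcal{E}$ sum to $O$ if and only if they are the intersection points (with multiplicity) of $\mathcal{E}$ with a line. *)

theory Defs
  imports
    "HOL-Algebra.Group"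
    "HOL-Computational_Algebra.Polynomial"
    "HOL-Library.Multiset"
begin

(* Polymorphic in the coefficient ring: it is evaluated at rationals, and at rational polynomials
   in order to restrict it to a line. *)
definition q :: "'a::comm_ring_1 \<Rightarrow> 'a \<Rightarrow> 'a \<Rightarrow> 'a" where
  "q a b c = - (c^3) - c^2 * (a + b) + c * (a^2 + a * b + b^2)
     + (a^3 + a^2 * b + a * b^2 + b^3)"

text \<open>Points of the rational projective plane are classes of nonzero triples up to scaling; thus
  \<open>(a, b, c) \<in> P\<close> says that \<open>(a, b, c)\<close> are homogeneous coordinates of \<open>P\<close>.\<close>

type_synonym triple = "rat \<times> rat \<times> rat"

definition proportional :: "(triple \<times> triple) set" where
  "proportional = {((a, b, c), (a', b', c')).
     \<exists>k. k \<noteq> 0 \<and> a' = k * a \<and> b' = k * b \<and> c' = k * c}"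

definition proj_plane :: "triple set set" where
  "proj_plane = (UNIV - {(0, 0, 0)}) // proportional"

definition proj_point :: "rat \<Rightarrow> rat \<Rightarrow> rat \<Rightarrow> triple set" where
  "proj_point a b c = proportional `` {(a, b, c)}"

definition proj_line :: "rat \<Rightarrow> rat \<Rightarrow> rat \<Rightarrow> triple set set" where
  "proj_line u v w = {P \<in> proj_plane. \<forall>(a, b, c) \<in> P. u * a + v * b + w * c = 0}"

definition proj_lines :: "triple set set set" where
  "proj_lines = {proj_line u v w | u v w. (u, v, w) \<noteq> (0, 0, 0)}"

definition rational_points :: "triple set set" where
  "rational_points = {P \<in> proj_plane. \<forall>(a, b, c) \<in> P. q a b c = 0}"

text \<open>Intersection multiplicity at \<open>P\<close> of the line \<open>L\<close> with the cubic: the order of vanishing at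
  \<open>t = 0\<close> of \<open>q(x + t y)\<close>, where \<open>x\<close> represents \<open>P\<close> and \<open>y\<close> represents any other point of \<open>L\<close>.
  The order does not depend on these choices, and the polynomial is never zero because the cubic,
  being smooth, contains no line. The multiplicity is \<open>0\<close> at points of \<open>L\<close> off the cubic.\<close>

definition intersection_mult :: "triple set set \<Rightarrow> triple set \<Rightarrow> nat" where
  "intersection_mult L P =
     (if P \<in> L then
        (THE m. \<forall>(a, b, c) \<in> P. \<forall>(a', b', c') \<in> \<Union>(L - {P}).
           Polynomial.order 0 (q [:a, a':] [:b, b':] [:c, c':]) = m)
      else 0)"

definition cut_out_by_line :: "triple set multiset \<Rightarrow> bool" where
  "cut_out_by_line M \<longleftrightarrow>
     (\<exists>L \<in> proj_lines. \<forall>X \<in> proj_plane. intersection_mult L X = count M X)"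

text \<open>The third intersection point of the chord through \<open>P\<close> and \<open>Q\<close>, or of the tangent at \<open>P\<close>
  if \<open>P = Q\<close>.\<close>

definition third_point :: "triple set \<Rightarrow> triple set \<Rightarrow> triple set" where
  "third_point P Q = (THE R. R \<in> rational_points \<and> cut_out_by_line {#P, Q, R#})"

definition point_O :: "triple set" where
  "point_O = proj_point 1 (-1) 0"

definition point_A :: "triple set" where
  "point_A = proj_point 1 0 (-1)"

text \<open>As \<open>O\<close> is an inflexion point, \<open>third_point R O\<close> is the inverse of \<open>R\<close>, so that the sum of
  three points is \<open>O\<close> exactly if they are cut out by a line.\<close>

definition mordell_weil :: "triple set monoid" where
  "mordell_weil =
     \<lparr>carrier = rational_points,
      monoid.mult = (\<lambda>P Q. third_point (third_point P Q) point_O),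
      one = point_O\<rparr>"

end

theory Submission
  imports Defs "HOL-Computational_Algebra.Primes"
begin

text \<open>
  Translation by \<open>A\<close> is the composition \<open>i \<circ> j\<close> of the involutions \<open>j P = third_point P A\<close> and
  \<open>i P = third_point P O = - P\<close> of the set of rational points, so associativity of the group law is
  not needed. If \<open>n A = O\<close> then \<open>(n - k) A = - (k A)\<close> for all \<open>k \<le> n\<close>. For \<open>n = 2 k + 1\<close> it follows that \<open>k A\<close>
  is fixed by \<open>j\<close>, that is, the tangent at \<open>k A\<close> passes through \<open>A\<close>; but no tangent at another real
  point passes through \<open>A\<close>, and \<open>A\<close> is not an inflexion point. For \<open>n = 2 k\<close> it follows that \<open>k A\<close> is
  fixed by \<open>i\<close>, so it is \<open>O\<close> or the 2-torsion point \<open>(1 : 1 : -1)\<close>. A 2-descent invariant excludes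
  the latter, and \<open>k A = O\<close> leads to an infinite descent.
\<close>

section \<open>Points and lines\<close>

fun cubic :: "triple \<Rightarrow> rat" where
  "cubic (a, b, c) = q a b c"

fun grad :: "triple \<Rightarrow> triple" where
  "grad (a, b, c) =
     (3 * a^2 + 2 * a * b + b^2 + c * (2 * a + b) - c^2,
      a^2 + 2 * a * b + 3 * b^2 + c * (a + 2 * b) - c^2,
      a^2 + a * b + b^2 - 2 * c * (a + b) - 3 * c^2)"

fun dot :: "triple \<Rightarrow> triple \<Rightarrow> rat" where
  "dot (a, b, c) (a', b', c') = a * a' + b * b' + c * c'"

fun cross :: "triple \<Rightarrow> triple \<Rightarrow> triple" where
  "cross (a, b, c) (a', b', c') = (b * c' - c * b', c * a' - a * c', a * b' - b * a')"

text \<open>Scalar multiples are written \<open>comb k x 0 y\<close> with an arbitrary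
  \<open>y\<close>, so that one operation serves for them too.\<close>

fun comb :: "rat \<Rightarrow> triple \<Rightarrow> rat \<Rightarrow> triple \<Rightarrow> triple" where
  "comb u (a, b, c) v (a', b', c') = (u * a + v * a', u * b + v * b', u * c + v * c')"

fun restr :: "triple \<Rightarrow> triple \<Rightarrow> rat poly" where
  "restr (a, b, c) (a', b', c') = q [:a, a':] [:b, b':] [:c, c':]"

definition cls :: "triple \<Rightarrow> triple set" where
  "cls x = proportional `` {x}"

fun line :: "triple \<Rightarrow> triple set set" where
  "line (u, v, w) = proj_line u v w"

abbreviation zero3 :: triple where
  "zero3 \<equiv> (0, 0, 0)"

text \<open>Taylor expansion of a form of degree 3; exchanging \<open>x\<close> and \<open>y\<close>
  relates the two mixed coefficients.\<close>

lemma cubic_comb: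
  "cubic (comb u x v y) =
     u^3 * cubic x + u^2 * v * dot (grad x) y + u * v^2 * dot (grad y) x + v^3 * cubic y"
  by (cases x; cases y) (simp add: q_def algebra_simps power2_eq_square power3_eq_cube)

lemma cubic_scale: "cubic (comb k x 0 y) = k^3 * cubic x"
  by (simp add: cubic_comb)

lemma poly_restr: "poly (restr x y) t = cubic (comb 1 x t y)"
  by (cases x; cases y) (simp add: q_def algebra_simps)

lemma restr_expand:
  "restr x y = [:cubic x, dot (grad x) y, dot (grad y) x, cubic y:]"
proof -
  have "poly (restr x y) = poly [:cubic x, dot (grad x) y, dot (grad y) x, cubic y:]"
    by (rule ext) (simp add: poly_restr cubic_comb algebra_simps power2_eq_square power3_eq_cube)
  then show ?thesis by (simp only: poly_eq_poly_eq_iff)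
qed

text \<open>Euler's identity for a form of degree 3.\<close>

lemma dot_grad_self: "dot (grad x) x = 3 * cubic x"
  by (cases x) (simp add: q_def algebra_simps power2_eq_square power3_eq_cube)

lemma grad_scale: "grad (comb k x 0 y) = comb (k^2) (grad x) 0 y"
  by (cases x; cases y) (simp add: algebra_simps power2_eq_square)

lemma dot_comb_right: "dot n (comb u x v y) = u * dot n x + v * dot n y"
  by (cases n; cases x; cases y) (simp add: algebra_simps)

lemma dot_comb_left: "dot (comb u x v y) n = u * dot x n + v * dot y n"
  by (cases n; cases x; cases y) (simp add: algebra_simps)

lemma cross_comb:
  "cross (comb u x v y) (comb u' x v' y) = comb (u * v' - u' * v) (cross x y) 0 y"
  by (cases x; cases y) (simp add: algebra_simps)

lemma dot_cross [simp]: "dot (cross x y) x = 0" "dot (cross x y) y = 0" "dot x (cross x y) = 0"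
  by (cases x; cases y; simp add: algebra_simps)+

lemma comb_simps [simp]: "comb 1 x 0 y = x" "comb 0 x 1 y = y" "comb 0 x 0 y = zero3"
  by (cases x; cases y; simp)+

lemma comb_zero_right: "comb k x 0 y = comb k x 0 z"
  by (cases x; cases y; cases z) simp

lemma comb_scale_eq_0_iff: "comb k x 0 y = zero3 \<longleftrightarrow> k = 0 \<or> x = zero3"
  by (cases x; cases y) auto

lemma cross_zero [simp]: "cross x zero3 = zero3" "cross zero3 x = zero3" "cross x x = zero3"
  by (cases x; simp)+

lemma cross_eq_0_iff:
  assumes "x \<noteq> zero3" "y \<noteq> zero3"
  shows "cross x y = zero3 \<longleftrightarrow> (\<exists>k. k \<noteq> 0 \<and> y = comb k x 0 x)"
proof
  obtain a b c where x: "x = (a, b, c)" by (cases x)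
  obtain a' b' c' where y: "y = (a', b', c')" by (cases y)
  assume "cross x y = zero3"
  then have e: "b * c' = c * b'" "c * a' = a * c'" "a * b' = b * a'"
    by (auto simp: x y)
  consider "a \<noteq> 0" | "b \<noteq> 0" | "c \<noteq> 0" using assms x by auto
  then have "\<exists>k. y = comb k x 0 x"
  proof cases
    case 1
    then have "y = comb (a' / a) x 0 x" using e by (simp add: x y field_simps)
    then show ?thesis ..
  next
    case 2
    then have "y = comb (b' / b) x 0 x" using e by (simp add: x y field_simps)
    then show ?thesis ..
  next
    case 3
    then have "y = comb (c' / c) x 0 x" using e by (simp add: x y field_simps)
    then show ?thesis ..
  qed
  then show "\<exists>k. k \<noteq> 0 \<and> y = comb k x 0 x"
    using assms(2) comb_scale_eq_0_iff by metis
next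
  assume "\<exists>k. k \<noteq> 0 \<and> y = comb k x 0 x"
  then show "cross x y = zero3" by (cases x) (auto simp: algebra_simps)
qed

section \<open>Projective points as classes of triples\<close>

lemma mem_cls: "y \<in> cls x \<longleftrightarrow> (\<exists>k. k \<noteq> 0 \<and> y = comb k x 0 x)"
  by (cases x; cases y) (auto simp: cls_def proportional_def)

lemma self_mem_cls [simp]: "x \<in> cls x"
  unfolding mem_cls by (rule exI[of _ 1]) simp

lemma equiv_proportional: "equiv UNIV proportional"
proof (rule equivI)
  show "refl proportional"
    by (auto simp: refl_on_def proportional_def intro: exI[of _ 1])
  show "sym proportional"
    unfolding sym_def proportional_def
    apply clarsimp
    subgoal for a b c k by (rule exI[of _ "1 / k"]) simp
    done
  show "trans proportional"
    unfolding trans_def proportional_def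
    apply clarsimp
    subgoal for a b c k l by (rule exI[of _ "l * k"]) simp
    done
qed auto

lemma cls_eq_iff_mem: "cls x = cls y \<longleftrightarrow> y \<in> cls x"
  unfolding cls_def using equiv_class_eq_iff[OF equiv_proportional, of x y] by auto

lemma cls_eq_iff:
  assumes "x \<noteq> zero3" "y \<noteq> zero3"
  shows "cls x = cls y \<longleftrightarrow> cross x y = zero3"
  using assms by (simp add: cls_eq_iff_mem mem_cls cross_eq_0_iff)

lemma cls_scale: "k \<noteq> 0 \<Longrightarrow> cls (comb k x 0 y) = cls x"
  by (metis cls_eq_iff_mem comb_zero_right mem_cls)

lemma proj_plane_iff: "X \<in> proj_plane \<longleftrightarrow> (\<exists>x. x \<noteq> zero3 \<and> X = cls x)"
  by (auto simp: proj_plane_def quotient_def cls_def)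

lemma proj_planeE:
  assumes "X \<in> proj_plane" obtains x where "x \<noteq> zero3" "X = cls x"
  using assms proj_plane_iff by auto

lemma cls_in_proj_plane: "cls x \<in> proj_plane \<longleftrightarrow> x \<noteq> zero3"
proof
  assume "cls x \<in> proj_plane"
  then obtain y where "y \<noteq> zero3" "cls x = cls y" by (auto simp: proj_plane_iff)
  then show "x \<noteq> zero3"
    by (metis cls_eq_iff_mem comb_scale_eq_0_iff mem_cls)
next
  show "x \<noteq> zero3 \<Longrightarrow> cls x \<in> proj_plane" unfolding proj_plane_iff by blast
qed

lemma cls_in_line:
  "cls x \<in> line n \<longleftrightarrow> x \<noteq> zero3 \<and> dot n x = 0"
proof -
  obtain u v w where n: "n = (u, v, w)" by (cases n)
  have "(\<forall>(a, b, c) \<in> cls x. u * a + v * b + w * c = 0) \<longleftrightarrow> (\<forall>y \<in> cls x. dot n y = 0)"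
    by (auto simp: n)
  also have "\<dots> \<longleftrightarrow> dot n x = 0"
    by (auto simp: mem_cls dot_comb_right intro: exI[of _ "1::rat"])
  finally show ?thesis by (simp add: n proj_line_def cls_in_proj_plane)
qed

lemma cls_in_rational_points:
  "cls x \<in> rational_points \<longleftrightarrow> x \<noteq> zero3 \<and> cubic x = 0"
proof -
  have "(\<forall>(a, b, c) \<in> cls x. q a b c = 0) \<longleftrightarrow> (\<forall>y \<in> cls x. cubic y = 0)"
    by auto
  also have "\<dots> \<longleftrightarrow> cubic x = 0"
    by (metis cubic_scale mem_cls mult_zero_right self_mem_cls)
  finally show ?thesis by (simp add: rational_points_def cls_in_proj_plane)
qed

lemma rational_pointsE:
  assumes "P \<in> rational_points"
  obtains x where "x \<noteq> zero3" "cubic x = 0" "P = cls x"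
  using assms by (metis (no_types, lifting) cls_in_rational_points mem_Collect_eq proj_planeE rational_points_def)

lemma proj_lines_iff: "L \<in> proj_lines \<longleftrightarrow> (\<exists>n. n \<noteq> zero3 \<and> L = line n)"
  by (auto simp: proj_lines_def)

lemma line_subset_proj_plane: "line n \<subseteq> proj_plane"
  by (cases n) (auto simp: proj_line_def)

lemma line_scale: 
  assumes k: "k \<noteq> 0"
  shows "line (comb k n 0 m) = line n"
proof (rule Set.set_eqI)
  fix X
  show "X \<in> line (comb k n 0 m) \<longleftrightarrow> X \<in> line n"
  proof (cases "X \<in> proj_plane")
    case True
    then show ?thesis using k by (auto elim!: proj_planeE simp: cls_in_line dot_comb_left)
  next
    case False
    then show ?thesis using line_subset_proj_plane by blast
  qed
qed

text \<open>By the triple product expansion \<open>n\<close> has zero cross product with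
  \<open>cross x y\<close>, so the two normals are proportional.\<close>

lemma line_eqI:
  assumes "n \<noteq> zero3" "cross x y \<noteq> zero3" "dot n x = 0" "dot n y = 0"
  shows "line n = line (cross x y)"
proof -
  have "cross n (cross x y) = comb (dot n y) x (- dot n x) y"
    by (cases n; cases x; cases y) (simp add: algebra_simps)
  then have "cross n (cross x y) = zero3" using assms by (cases x; cases y) simp
  then obtain k where "k \<noteq> 0" "cross x y = comb k n 0 n"
    using cross_eq_0_iff assms by blast
  then show ?thesis by (simp add: line_scale)
qed

lemma dot_self_eq_0_iff: "dot n n = 0 \<longleftrightarrow> n = zero3"
proof (cases n)
  case (fields a b c)
  have "a * a + b * b + c * c = 0 \<longleftrightarrow> a = 0 \<and> b = 0 \<and> c = 0"
    by (metis add_nonneg_eq_0_iff add_nonneg_nonneg mult_eq_0_iff zero_le_square)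
  then show ?thesis by (simp add: fields)
qed

lemma in_span:
  assumes "cross x y \<noteq> zero3" "dot (cross x y) z = 0"
  obtains u v where "z = comb u x v y"
proof -
  define n where "n = cross x y"
  have nn: "dot n n \<noteq> 0" using assms(1) by (simp add: n_def dot_self_eq_0_iff)
  \<comment> \<open>Cramer's rule in the basis \<open>x\<close>, \<open>y\<close>, \<open>n\<close>,
    multiplied by the determinant \<open>dot n n\<close>, which is positive over an ordered
    field.\<close>
  have "comb (dot n n) z (- dot n z) n = comb (dot (cross z y) n) x (dot (cross x z) n) y"
    unfolding n_def by (cases x; cases y; cases z) (simp add: algebra_simps power2_eq_square)
  then have "comb (dot n n) z 0 n = comb (dot (cross z y) n) x (dot (cross x z) n) y"
    using assms(2) by (simp add: n_def)
  moreover have "z = comb (u / d) x (v / d) y"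
    if "comb d z 0 n = comb u x v y" "d \<noteq> 0" for d u v
    using that by (cases x; cases y; cases z; cases n) (simp add: field_simps)
  ultimately show ?thesis using nn that by blast
qed

section \<open>Intersection multiplicities\<close>

lemma order_0_linear:
  fixes c d :: "'a::idom"
  assumes "c \<noteq> 0 \<or> d \<noteq> 0"
  shows "order 0 [:c, d:] = of_bool (c = 0)"
proof (cases "c = 0")
  case True
  then have "d \<noteq> 0" using assms by simp
  then have "order 0 [:0, d:] \<noteq> 0" "order 0 [:0, d:] \<le> 1"
    using order_root[of "[:0, d:]" 0] order_degree[of "[:0, d:]" 0] by simp_all
  then show ?thesis using True by simp
qed (simp add: order_0I)

lemma order_0_pCons:
  fixes p :: "'a::idom poly"
  assumes "coeff p 0 \<noteq> 0"
  shows "order 0 (pCons 0 p) = 1"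
proof -
  have "order 0 (pCons 0 p) = order 0 ([:0, 1:] * p)" by simp
  also have "\<dots> = 1"
    using assms by (subst order_mult) (auto simp: order_0_linear order_0I poly_0_coeff_0)
  finally show ?thesis .
qed

text \<open>The second point \<open>Y\<close> makes the description unique: if \<open>L\<close> had
  no point besides \<open>P\<close>, every \<open>m\<close> would satisfy the condition
  vacuously.\<close>

lemma intersection_mult_eqI:
  assumes "x \<in> P" "P \<in> L" "y \<in> Y" "Y \<in> L" "Y \<noteq> P"
    and ord: "\<And>x y Y. \<lbrakk>x \<in> P; y \<in> Y; Y \<in> L; Y \<noteq> P\<rbrakk> \<Longrightarrow> order 0 (restr x y) = m"
  shows "intersection_mult L P = m"
proof -
  have restr: "restr x y = (case x of (a, b, c) \<Rightarrow> case y of (a', b', c') \<Rightarrow> q [:a, a':] [:b, b':] [:c, c':])"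
    for x y by (cases x; cases y) simp
  have "(THE k. \<forall>x \<in> P. \<forall>y \<in> \<Union>(L - {P}). order 0 (restr x y) = k) = m"
  proof (rule the_equality)
    show "\<forall>x \<in> P. \<forall>y \<in> \<Union>(L - {P}). order 0 (restr x y) = m" using ord by blast
    show "k = m" if "\<forall>x \<in> P. \<forall>y \<in> \<Union>(L - {P}). order 0 (restr x y) = k" for k
    proof -
      have "order 0 (restr x y) = k" using that assms(1-5) by blast
      then show ?thesis using ord assms(1-5) by simp
    qed
  qed
  then show ?thesis using \<open>P \<in> L\<close> by (simp add: intersection_mult_def restr split_def)
qed

lemma cls_neq_memD:
  assumes "x \<in> P" "P = cls x0" "y \<in> Y" "Y \<in> line n" "P \<in> line n" "Y \<noteq> P"
  shows "x \<noteq> zero3" "y \<noteq> zero3" "dot n x = 0" "dot n y = 0" "cross x y \<noteq> zero3"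
    "P = cls x" "Y = cls y"
proof -
  obtain y0 where y0: "Y = cls y0" using assms(4) line_subset_proj_plane proj_planeE by blast
  show P: "P = cls x" using assms(1,2) by (simp add: cls_eq_iff_mem)
  show Y: "Y = cls y" using assms(3) y0 by (simp add: cls_eq_iff_mem)
  have "cls x \<in> line n" "cls y \<in> line n" using assms(4,5) P Y by simp_all
  then show xy: "x \<noteq> zero3" "y \<noteq> zero3" "dot n x = 0" "dot n y = 0"
    by (simp_all add: cls_in_line)
  have "cls x \<noteq> cls y" using assms(6) P Y by simp
  then show "cross x y \<noteq> zero3" using cls_eq_iff[OF xy(1,2)] by simp
qed

text \<open>The constant coefficient of \<open>restr x y\<close> vanishes and the linear one is
  \<open>dot (grad x) y\<close>. By Euler's identity, other representatives only multiply the latter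
  by \<open>k^2 * v\<close>, which is not zero.\<close>

lemma intersection_mult_simple:
  assumes n: "n \<noteq> zero3" and x: "cls x \<in> line n" "cubic x = 0" and y: "dot n y = 0" "dot (grad x) y \<noteq> 0"
  shows "intersection_mult (line n) (cls x) = 1"
proof -
  have nz: "x \<noteq> zero3" "dot n x = 0" using x by (simp_all add: cls_in_line)
  have y0: "y \<noteq> zero3" using y(2) by (cases x) auto
  have cr: "cross x y \<noteq> zero3"
  proof
    assume "cross x y = zero3"
    then obtain k where "y = comb k x 0 x" using cross_eq_0_iff nz(1) y0 by blast
    then show False using y(2) x(2) by (simp add: dot_comb_right dot_grad_self)
  qed
  show ?thesis
  proof (rule intersection_mult_eqI[where x = x and y = y and Y = "cls y"])
    show "cls y \<in> line n" using y y0 by (simp add: cls_in_line)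
    show "cls y \<noteq> cls x" using cr cls_eq_iff y0 nz(1) by metis
  next
    fix x' y' Y assume *: "x' \<in> cls x" "y' \<in> Y" "Y \<in> line n" "Y \<noteq> cls x"
    note D = cls_neq_memD[OF *(1) refl *(2,3) x(1) *(4)]
    obtain k where k: "k \<noteq> 0" "x' = comb k x 0 y"
      using *(1) unfolding mem_cls comb_zero_right[of _ x x y] by blast
    have "line n = line (cross x y)" using line_eqI n cr nz(2) y(1) by blast
    then have "dot (cross x y) y' = 0" using D(7) *(3) cls_in_line by metis
    then obtain u v where uv: "y' = comb u x v y" using in_span cr by metis
    have "cross x' y' = comb (k * v) (cross x y) 0 y" using uv k(2) cross_comb by simp
    then have "v \<noteq> 0" using D(5) comb_scale_eq_0_iff by auto
    have "cubic x' = 0" by (simp add: k(2) cubic_scale x(2))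
    moreover have "dot (grad x') y' = k^2 * (v * dot (grad x) y)"
      using x(2) by (simp add: k(2) grad_scale dot_comb_left uv dot_comb_right dot_grad_self)
    ultimately show "order 0 (restr x' y') = 1"
      using k(1) \<open>v \<noteq> 0\<close> y(2) by (simp add: restr_expand order_0_pCons)
  qed (use x in auto)
qed

text \<open>In the coordinates \<open>u\<close>, \<open>v\<close> of the line through
  \<open>x\<close> and \<open>y\<close> the cubic is a binary form with the roots
  \<open>(p : r)\<close>. The multiplicity at a point counts the linear factors that vanish there,
  so repeated roots need no separate cases.\<close>

lemma cut_out_by_lineI:
  assumes xy: "cross x y \<noteq> zero3" and k: "k \<noteq> 0"
    and nz: "p1 \<noteq> 0 \<or> r1 \<noteq> 0" "p2 \<noteq> 0 \<or> r2 \<noteq> 0" "p3 \<noteq> 0 \<or> r3 \<noteq> 0"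
    and factor: "\<And>u v. cubic (comb u x v y) =
      k * (p1 * v - r1 * u) * (p2 * v - r2 * u) * (p3 * v - r3 * u)"
  shows "cut_out_by_line {#cls (comb p1 x r1 y), cls (comb p2 x r2 y), cls (comb p3 x r3 y)#}"
proof -
  let ?M = "{#cls (comb p1 x r1 y), cls (comb p2 x r2 y), cls (comb p3 x r3 y)#}"
  define L where "L = line (cross x y)"
  have comb_eq_0: "comb u x v y = zero3 \<longleftrightarrow> u = 0 \<and> v = 0" for u v
  proof
    assume z: "comb u x v y = zero3"
    have "cross (comb u x v y) (comb 0 x 1 y) = comb u (cross x y) 0 y"
      "cross (comb 1 x 0 y) (comb u x v y) = comb v (cross x y) 0 y"
      unfolding cross_comb by simp_all
    then show "u = 0 \<and> v = 0" using xy comb_scale_eq_0_iff unfolding z cross_zero by metis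
  qed simp
  have in_L: "cls (comb u x v y) \<in> L" if "u \<noteq> 0 \<or> v \<noteq> 0" for u v
    using that comb_eq_0 by (auto simp: L_def cls_in_line dot_comb_right)
  have cls_comb_eq: "cls (comb p x r y) = cls (comb u x v y) \<longleftrightarrow> p * v - r * u = 0"
    if "p \<noteq> 0 \<or> r \<noteq> 0" "u \<noteq> 0 \<or> v \<noteq> 0" for p r u v
  proof -
    have "cls (comb p x r y) = cls (comb u x v y) \<longleftrightarrow>
        comb (p * v - u * r) (cross x y) 0 y = zero3"
      using that comb_eq_0 by (subst cls_eq_iff) (simp_all add: cross_comb)
    then show ?thesis using xy by (simp add: comb_scale_eq_0_iff mult.commute)
  qed
  have order: "order 0 (restr (comb u x v y) (comb u' x v' y)) =
      of_bool (p1 * v - r1 * u = 0) + of_bool (p2 * v - r2 * u = 0) + of_bool (p3 * v - r3 * u = 0)"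
    if "u * v' - u' * v \<noteq> 0" for u v u' v'
  proof -
    \<comment> \<open>\<open>l p r\<close> is the factor of the root \<open>(p : r)\<close> along
      the parametrised line. It is not zero, since the parameters form a matrix with determinant
      \<open>u * v' - u' * v\<close>.\<close>
    define l where "l p r = [:p * v - r * u, p * v' - r * u':]" for p r
    have l0: "p * v - r * u \<noteq> 0 \<or> p * v' - r * u' \<noteq> 0" if "p \<noteq> 0 \<or> r \<noteq> 0" for p r
    proof (rule ccontr)
      assume "\<not> ?thesis"
      then have "p * v = r * u" "p * v' = r * u'" by auto
      moreover have "p * (u * v' - u' * v) = u * (p * v') - u' * (p * v)"
        "r * (u * v' - u' * v) = v' * (r * u) - v * (r * u')"
        by (simp_all add: algebra_simps)
      ultimately have "p * (u * v' - u' * v) = u * (r * u') - u' * (r * u)"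
        "r * (u * v' - u' * v) = v' * (p * v) - v * (p * v')"
        by argo+
      then have "p * (u * v' - u' * v) = 0" "r * (u * v' - u' * v) = 0"
        by (simp_all add: mult.left_commute mult.commute)
      then show False using that \<open>u * v' - u' * v \<noteq> 0\<close> by simp
    qed
    have "poly (restr (comb u x v y) (comb u' x v' y)) = poly (smult k (l p1 r1 * l p2 r2 * l p3 r3))"
    proof
      fix t
      have "comb 1 (comb u x v y) t (comb u' x v' y) = comb (u + t * u') x (v + t * v') y"
        by (cases x; cases y) (simp add: algebra_simps)
      then show "poly (restr (comb u x v y) (comb u' x v' y)) t =
          poly (smult k (l p1 r1 * l p2 r2 * l p3 r3)) t"
        by (simp add: poly_restr factor l_def algebra_simps)
    qed
    then have "restr (comb u x v y) (comb u' x v' y) = smult k (l p1 r1 * l p2 r2 * l p3 r3)"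
      by (simp only: poly_eq_poly_eq_iff)
    moreover have "l p1 r1 \<noteq> 0" "l p2 r2 \<noteq> 0" "l p3 r3 \<noteq> 0"
      using l0 nz by (auto simp: l_def)
    moreover have "order 0 (l p r) = of_bool (p * v - r * u = 0)" if "p \<noteq> 0 \<or> r \<noteq> 0" for p r
      unfolding l_def using l0[OF that] by (rule order_0_linear)
    ultimately show ?thesis using k nz by (simp add: order_smult order_mult)
  qed
  have "intersection_mult L X = count ?M X" if "X \<in> proj_plane" for X
  proof (cases "X \<in> L")
    case False
    then have "X \<noteq> cls (comb p1 x r1 y)" "X \<noteq> cls (comb p2 x r2 y)" "X \<noteq> cls (comb p3 x r3 y)"
      using in_L nz by blast+
    then have "count ?M X = 0" by simp
    then show ?thesis using False by (simp add: intersection_mult_def)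
  next
    case True
    from that obtain z where z: "z \<noteq> zero3" "X = cls z" by (rule proj_planeE)
    \<comment> \<open>The line has two different points, so at least one of them differs from
      \<open>X\<close>.\<close>
    have "cls x \<noteq> cls y" using cls_comb_eq[of 1 0 0 1] by simp
    then obtain y0 where y0: "cls y0 \<in> L" "cls y0 \<noteq> X"
      using in_L[of 1 0] in_L[of 0 1] by (cases "cls x = X") auto
    define Y where "Y = cls y0"
    have Y: "Y \<in> L" "Y \<noteq> X" "Y = cls y0" using y0 by (simp_all add: Y_def)
    show ?thesis
    proof (rule intersection_mult_eqI[OF _ True _ Y(1,2)])
      show "z \<in> X" "y0 \<in> Y" using z Y by simp_all
    next
      fix x' y' Y' assume *: "x' \<in> X" "y' \<in> Y'" "Y' \<in> L" "Y' \<noteq> X"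
      note D = cls_neq_memD[OF *(1) z(2) *(2) *(3)[unfolded L_def] True[unfolded L_def] *(4)]
      obtain u v where uv: "x' = comb u x v y" using in_span[OF xy D(3)] .
      obtain u' v' where uv': "y' = comb u' x v' y" using in_span[OF xy D(4)] .
      have 1: "u * v' - u' * v \<noteq> 0"
        using D(5) xy unfolding uv uv' cross_comb comb_scale_eq_0_iff by simp
      then have 2: "u \<noteq> 0 \<or> v \<noteq> 0" by auto
      show "order 0 (restr x' y') = count ?M X"
        unfolding D(6) unfolding uv uv' order[OF 1] using cls_comb_eq[OF _ 2] nz by simp
    qed
  qed
  moreover have "L \<in> proj_lines" using xy proj_lines_iff L_def by blast
  ultimately show ?thesis unfolding cut_out_by_line_def by blast
qed

lemma rational_points_subset: "rational_points \<subseteq> proj_plane"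
  by (auto simp: rational_points_def)

lemma cross_cross_self: "cross x (cross n x) = comb (dot x x) n (- dot n x) x"
  by (cases x; cases n) (simp add: algebra_simps)

section \<open>Chords and tangents\<close>

text \<open>Two different points span their line. If they coincide, a multiplicity of at least 2
  there annihilates the linear term of the restriction, so the line is the tangent.\<close>

lemma line_unique:
  assumes n: "n \<noteq> zero3"
    and x: "x \<noteq> zero3" "cubic x = 0" and y: "y \<noteq> zero3"
    and grad: "cls x = cls y \<Longrightarrow> grad x \<noteq> zero3"
    and mult: "\<And>X. X \<in> proj_plane \<Longrightarrow>
      intersection_mult (line n) X = count {#cls x, cls y, R#} X"
  shows "line n = line (if cls x = cls y then grad x else cross x y)"
proof -
  have on_line: "cls z \<in> line n"
    if "cls z \<in># {#cls x, cls y, R#}" "z \<noteq> zero3" for z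
  proof (rule ccontr)
    assume "cls z \<notin> line n"
    then have "count {#cls x, cls y, R#} (cls z) = 0"
      using mult[of "cls z"] that(2) by (simp add: intersection_mult_def cls_in_proj_plane)
    then have "cls z \<notin># {#cls x, cls y, R#}" unfolding count_eq_zero_iff .
    then show False using that(1) by contradiction
  qed
  have L: "cls x \<in> line n" "cls y \<in> line n" using on_line x(1) y by simp_all
  then have dots: "dot n x = 0" "dot n y = 0" by (simp_all add: cls_in_line)
  show ?thesis
  proof (cases "cls x = cls y")
    case False
    then show ?thesis using line_eqI[OF n _ dots] x(1) y by (simp add: cls_eq_iff)
  next
    case True
    \<comment> \<open>A second point of the line: \<open>cross x w\<close> is a nonzero multiple of
      \<open>n\<close>.\<close>
    define w where "w = cross n x"
    have "cross x w = comb (dot x x) n 0 x"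
      using dots(1) by (simp add: w_def cross_cross_self)
    then have w: "cross x w \<noteq> zero3" "dot n w = 0"
      using x(1) n by (simp_all add: w_def comb_scale_eq_0_iff dot_self_eq_0_iff)
    have "intersection_mult (line n) (cls x) \<noteq> 1"
      using mult[of "cls x"] x(1) y True by (simp add: cls_in_proj_plane)
    then have "dot (grad x) w = 0"
      using intersection_mult_simple[OF n L(1) x(2) w(2)] by blast
    then have "line (grad x) = line (cross x w)"
      using line_eqI[OF grad[OF True] w(1)] x(2) by (simp add: dot_grad_self)
    moreover have "line n = line (cross x w)" using line_eqI[OF n w(1) dots(1) w(2)] .
    ultimately show ?thesis using True by simp
  qed
qed

text \<open>Both multisets belong to the same line, so the multiplicities agree, and cancelling the
  two common points leaves the third.\<close>

lemma cut_out_by_line_unique: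
  assumes x: "x \<noteq> zero3" "cubic x = 0" and y: "y \<noteq> zero3"
    and R: "R \<in> proj_plane" "R' \<in> proj_plane"
    and grad: "cls x = cls y \<Longrightarrow> grad x \<noteq> zero3"
    and cut: "cut_out_by_line {#cls x, cls y, R#}" "cut_out_by_line {#cls x, cls y, R'#}"
  shows "R = R'"
proof -
  let ?n = "if cls x = cls y then grad x else cross x y"
  have mult: "intersection_mult (line ?n) X = count {#cls x, cls y#} X + count {#S#} X"
    if "cut_out_by_line {#cls x, cls y, S#}" "X \<in> proj_plane" for S X
  proof -
    from that(1) obtain n where n: "n \<noteq> zero3"
      "\<And>X. X \<in> proj_plane \<Longrightarrow> intersection_mult (line n) X = count {#cls x, cls y, S#} X"
      unfolding cut_out_by_line_def by (metis proj_lines_iff)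
    have "line n = line ?n" by (rule line_unique[OF n(1) x y grad n(2)])
    then have "intersection_mult (line ?n) X = count ({#cls x, cls y#} + {#S#}) X"
      using n(2)[OF that(2)] by simp
    then show ?thesis by (simp only: count_union)
  qed
  have "count {#R#} R = count {#R'#} R"
    using mult[OF cut(1) R(1)] mult[OF cut(2) R(1)] by linarith
  then show ?thesis by (auto split: if_splits)
qed

text \<open>On the chord the cubic is \<open>u * v * (\<beta> * u + \<gamma> * v)\<close>, whose
  third root is \<open>(- \<gamma> : \<beta>)\<close>; \<open>nz\<close> says that this form is not
  identically zero.\<close>

lemma cut_out_chord:
  fixes x y
  defines "\<beta> \<equiv> dot (grad x) y" and "\<gamma> \<equiv> dot (grad y) x"
  assumes xy: "x \<noteq> zero3" "y \<noteq> zero3" "cubic x = 0" "cubic y = 0" "cls x \<noteq> cls y"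
    and nz: "\<beta> \<noteq> 0 \<or> \<gamma> \<noteq> 0"
  shows "cut_out_by_line {#cls x, cls y, cls (comb (- \<gamma>) x \<beta> y)#}"
    and "cls (comb (- \<gamma>) x \<beta> y) \<in> rational_points"
proof -
  have cr: "cross x y \<noteq> zero3" using xy by (simp add: cls_eq_iff)
  have "cubic (comb u x v y) = 1 * (1 * v - 0 * u) * (0 * v - 1 * u) * (- \<gamma> * v - \<beta> * u)" for u v
    by (simp add: cubic_comb xy \<beta>_def \<gamma>_def algebra_simps power2_eq_square)
  from cut_out_by_lineI[OF cr _ _ _ _ this]
  show cut: "cut_out_by_line {#cls x, cls y, cls (comb (- \<gamma>) x \<beta> y)#}"
    using nz by auto
  have "comb (- \<gamma>) x \<beta> y \<noteq> zero3"
  proof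
    assume z: "comb (- \<gamma>) x \<beta> y = zero3"
    have "cross (comb (- \<gamma>) x \<beta> y) (comb 0 x 1 y) = comb (- \<gamma>) (cross x y) 0 y"
      "cross (comb 1 x 0 y) (comb (- \<gamma>) x \<beta> y) = comb \<beta> (cross x y) 0 y"
      unfolding cross_comb by simp_all
    then show False using cr nz comb_scale_eq_0_iff unfolding z cross_zero by (metis neg_equal_0_iff_equal)
  qed
  moreover have "cubic (comb (- \<gamma>) x \<beta> y) = 0"
    by (simp add: cubic_comb xy flip: \<beta>_def \<gamma>_def) (simp add: power2_eq_square)
  ultimately show "cls (comb (- \<gamma>) x \<beta> y) \<in> rational_points"
    by (simp add: cls_in_rational_points)
qed

section \<open>Lines through A and O in coordinates\<close>

abbreviation A3 :: triple where "A3 \<equiv> (1, 0, -1)"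
abbreviation O3 :: triple where "O3 \<equiv> (1, -1, 0)"

lemma point_cls: "point_A = cls A3" "point_O = cls O3"
  by (simp_all add: point_A_def point_O_def proj_point_def cls_def)

lemma point_A_rational: "point_A \<in> rational_points"
  by (simp add: point_cls cls_in_rational_points q_def)

lemma point_O_rational: "point_O \<in> rational_points"
  by (simp add: point_cls cls_in_rational_points q_def)

text \<open>The tangent at A is the line \<open>b = 0\<close>, spanned by \<open>A3\<close> and
  \<open>(1, 0, 1)\<close>; the factor of A is double on it.\<close>

lemma cut_out_A_A: "cut_out_by_line {#point_A, point_A, cls (1, 0, 1)#}"
proof -
  have "cubic (comb u A3 v (1, 0, 1)) = -8 * (1 * v - 0 * u) * (1 * v - 0 * u) * (0 * v - 1 * u)"
    for u v by (simp add: q_def algebra_simps power2_eq_square power3_eq_cube)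
  from cut_out_by_lineI[OF _ _ _ _ _ this] show ?thesis by (simp add: point_cls)
qed

text \<open>On the tangent \<open>2 * a + 2 * b + c = 0\<close> the cubic is a constant times a
  cube: O is an inflexion point.\<close>

lemma cut_out_O_O: "cut_out_by_line {#point_O, point_O, point_O#}"
proof -
  have "cubic (comb u O3 v (0, 1, -2)) = 3 * (1 * v - 0 * u) * (1 * v - 0 * u) * (1 * v - 0 * u)"
    for u v by (simp add: q_def algebra_simps power2_eq_square power3_eq_cube)
  from cut_out_by_lineI[OF _ _ _ _ _ this] show ?thesis by (simp add: point_cls)
qed

text \<open>The chord formula with \<open>A3\<close> as the second point; \<open>R\<close> is the
  class of \<open>comb b (a, b, c) \<beta> A3\<close>.\<close>

lemma cut_out_A:
  assumes "(a, b, c) \<noteq> zero3" "q a b c = 0" "cls (a, b, c) \<noteq> point_A"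
  defines "\<beta> \<equiv> 2 * (a + c)^2 + b * (a + 3 * c)"
  defines "R \<equiv> cls (a * b + \<beta>, b^2, b * c - \<beta>)"
  shows "cut_out_by_line {#cls (a, b, c), point_A, R#}" "R \<in> rational_points"
proof -
  have \<beta>: "dot (grad (a, b, c)) A3 = \<beta>"
    by (simp add: \<beta>_def algebra_simps power2_eq_square)
  have \<gamma>: "dot (grad A3) (a, b, c) = - b" by simp
  have R: "R = cls (comb (- (- b)) (a, b, c) \<beta> A3)"
    by (simp add: R_def power2_eq_square algebra_simps)
  have on: "cubic A3 = 0" by (simp add: q_def)
  have fx: "cubic (a, b, c) = 0" and neq: "cls (a, b, c) \<noteq> cls A3"
    using assms(2,3) by (simp_all add: point_cls)
  have nz: "\<beta> \<noteq> 0 \<or> - b \<noteq> 0"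
  proof (rule ccontr)
    assume "\<not> ?thesis"
    then have "a + c = 0" "b = 0" by (auto simp: \<beta>_def)
    then have "c = - a" "b = 0" by (simp_all add: add_eq_0_iff)
    then show False using assms(1,3) by (simp add: point_cls cls_eq_iff)
  qed
  show "cut_out_by_line {#cls (a, b, c), point_A, R#}" "R \<in> rational_points"
    unfolding R point_cls
    using cut_out_chord[of "(a, b, c)" A3, unfolded \<beta> \<gamma>, OF assms(1) _ fx on neq nz] by simp_all
qed

text \<open>The cubic is symmetric in \<open>a\<close> and \<open>b\<close>, and
  \<open>(a, b, c)\<close> and \<open>(b, a, c)\<close> differ by a multiple of \<open>O3\<close>,
  so the chord through O exchanges them.\<close>

lemma cut_out_O:
  assumes "(a, b, c) \<noteq> zero3" "q a b c = 0" "cls (a, b, c) \<noteq> point_O"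
  shows "cut_out_by_line {#cls (a, b, c), point_O, cls (b, a, c)#}" "cls (b, a, c) \<in> rational_points"
proof -
  define z where "z = 2 * a + 2 * b + c"
  have \<beta>: "dot (grad (a, b, c)) O3 = (a - b) * z"
    by (simp add: z_def algebra_simps power2_eq_square)
  have \<gamma>: "dot (grad O3) (a, b, c) = z" by (simp add: z_def)
  \<comment> \<open>\<open>z = 0\<close> is the inflexional tangent, which meets the cubic only in
    O.\<close>
  have z: "z \<noteq> 0"
  proof
    assume "z = 0"
    then have c: "c = - 2 * (a + b)" by (simp add: z_def)
    have "q a b c = 3 * (a + b)^3"
      unfolding c by (simp add: q_def algebra_simps power2_eq_square power3_eq_cube)
    then have "a + b = 0" "c = 0" using assms(2) c by simp_all
    then show False using assms(1,3) by (simp add: point_cls cls_eq_iff add_eq_0_iff)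
  qed
  have on: "cubic O3 = 0" by (simp add: q_def)
  have "comb (- z) (a, b, c) ((a - b) * z) O3 = comb (- z) (b, a, c) 0 O3"
    by (simp add: algebra_simps)
  then have "cls (comb (- z) (a, b, c) ((a - b) * z) O3) = cls (b, a, c)"
    using z by (simp only: cls_scale neg_equal_0_iff_equal not_False_eq_True)
  note eq = this
  have fx: "cubic (a, b, c) = 0" and neq: "cls (a, b, c) \<noteq> cls O3"
    using assms(2,3) by (simp_all add: point_cls)
  show "cut_out_by_line {#cls (a, b, c), point_O, cls (b, a, c)#}" "cls (b, a, c) \<in> rational_points"
    unfolding eq[symmetric] point_cls
    using cut_out_chord[of "(a, b, c)" O3, unfolded \<beta> \<gamma>, OF assms(1) _ fx on neq] z by simp_all
qed

text \<open>Uniqueness is applied with \<open>Q\<close> as the first point: the gradient is visibly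
  nonzero at A and at O, which settles the tangent case \<open>P = Q\<close>.\<close>

lemma third_point_eqI:
  assumes "P \<in> rational_points" "R \<in> rational_points" "Q \<in> {point_A, point_O}"
    and cut: "cut_out_by_line {#P, Q, R#}"
  shows "third_point P Q = R"
  unfolding third_point_def
proof (rule the_equality)
  show "R \<in> rational_points \<and> cut_out_by_line {#P, Q, R#}" using assms by simp
next
  fix R' assume R': "R' \<in> rational_points \<and> cut_out_by_line {#P, Q, R'#}"
  obtain y where y: "y \<noteq> zero3" "cubic y = 0" "Q = cls y" "grad y \<noteq> zero3"
  proof -
    from assms(3) consider "Q = cls A3" | "Q = cls O3" by (auto simp: point_cls)
    then show ?thesis by cases (auto intro!: that simp: q_def)
  qed
  obtain x where x: "x \<noteq> zero3" "cubic x = 0" "P = cls x" using assms(1) rational_pointsE by blast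
  show "R' = R"
    using cut_out_by_line_unique[OF y(1,2) x(1), of R' R] y(3,4) x(3) R' cut assms(2)
      rational_points_subset by (auto simp: add_mset_commute)
qed

lemma ex_third_point:
  assumes "P \<in> rational_points" "Q \<in> {point_A, point_O}"
  shows "\<exists>R \<in> rational_points. cut_out_by_line {#P, Q, R#}"
proof (cases "P = Q")
  case True
  have "cls (1, 0, 1) \<in> rational_points" by (simp add: cls_in_rational_points q_def)
  then show ?thesis using True assms cut_out_A_A cut_out_O_O by blast
next
  case False
  obtain x where "x \<noteq> zero3" "cubic x = 0" "P = cls x"
    using assms(1) by (rule rational_pointsE)
  then obtain a b c where P: "(a, b, c) \<noteq> zero3" "q a b c = 0" and x: "P = cls (a, b, c)"
    by (cases x) simp
  from assms(2) consider "Q = point_A" | "Q = point_O" by blast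
  then show ?thesis
  proof cases
    case 1
    then show ?thesis using cut_out_A[OF P] False unfolding x by metis
  next
    case 2
    then show ?thesis using cut_out_O[OF P] False unfolding x by metis
  qed
qed

text \<open>Being cut out by a line is symmetric in the three points, which makes the map an
  involution.\<close>

lemma third_point_props:
  assumes "P \<in> rational_points" "Q \<in> {point_A, point_O}"
  shows "third_point P Q \<in> rational_points" "third_point (third_point P Q) Q = P"
proof -
  obtain R where R: "R \<in> rational_points" "cut_out_by_line {#P, Q, R#}"
    using ex_third_point[OF assms] by blast
  then have "cut_out_by_line {#R, Q, P#}" by (simp add: add_mset_commute)
  then have "third_point R Q = P" by (rule third_point_eqI[OF R(1) assms])
  moreover have "third_point P Q = R" by (rule third_point_eqI[OF assms(1) R(1) assms(2) R(2)])
  ultimately show "third_point P Q \<in> rational_points" "third_point (third_point P Q) Q = P"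
    using R(1) by simp_all
qed

section \<open>The multiples of A\<close>

lemma square_eq_prime_times_square_imp_0:
  fixes x y :: rat and p :: int
  assumes "prime p" "x^2 = of_int p * y^2"
  shows "y = 0"
proof (rule ccontr)
  assume "y \<noteq> 0"
  obtain a b where ab: "x / y = of_int a / of_int b" "b > 0" "coprime a b"
    using quotient_of_div quotient_of_denom_pos quotient_of_coprime by (metis surj_pair)
  have "(x / y)^2 = of_int p" using assms(2) \<open>y \<noteq> 0\<close> by (simp add: power_divide)
  then have "(of_int a :: rat)^2 = of_int p * of_int b^2"
    using ab(1,2) by (simp add: power_divide field_simps)
  then have eq: "a^2 = p * b^2"
    by (metis (no_types, lifting) of_int_eq_iff of_int_mult of_int_power)
  then have "p dvd a" using assms(1) prime_dvd_power by (metis dvd_triv_left)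
  then obtain k where "a = p * k" by blast
  then have "p * (p * k^2) = p * b^2" using eq by (simp add: power2_eq_square mult_ac)
  then have "b^2 = p * k^2" using assms(1) by simp
  then have "p dvd b" using assms(1) prime_dvd_power by (metis dvd_triv_left)
  then have "p dvd 1" using \<open>p dvd a\<close> ab(3) by (metis coprime_common_divisor)
  then show False using assms(1) not_prime_unit by blast
qed

fun torsion_quadric :: "triple \<Rightarrow> rat" where
  "torsion_quadric (a, b, c) = 2 * (a + b)^2 - (a + b) * c - 2 * c^2"

text \<open>This property separates the multiples of \<open>A\<close> from the 2-torsion point \<open>(1 : 1 : -1)\<close>, where
  \<open>torsion_quadric\<close> takes the value \<open>8\<close>. Up to squares \<open>- torsion_quadric\<close> is the homomorphism of
  2-descent attached to that point: the quadric touches the cubic at \<open>O\<close> and at the two 2-torsion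
  points defined over \<open>\<rat>(\<surd>17)\<close>.\<close>

definition square_up_to_sign :: "triple set \<Rightarrow> bool" where
  "square_up_to_sign P \<longleftrightarrow> (\<exists>x \<in> P. \<exists>r. torsion_quadric x = r^2 \<or> torsion_quadric x = - (r^2))"

lemma square_up_to_sign_cls: "square_up_to_sign (cls x) \<longleftrightarrow> (\<exists>r. torsion_quadric x = r^2 \<or> torsion_quadric x = - (r^2))"
proof
  assume "square_up_to_sign (cls x)"
  then obtain y r where y: "y \<in> cls x" "torsion_quadric y = r^2 \<or> torsion_quadric y = - (r^2)"
    unfolding square_up_to_sign_def by blast
  then obtain k where k: "k \<noteq> 0" "torsion_quadric (comb k x 0 x) = r^2 \<or> torsion_quadric (comb k x 0 x) = - (r^2)"
    unfolding mem_cls by auto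
  have "torsion_quadric (comb k x 0 x) = k^2 * torsion_quadric x"
    by (cases x) (simp add: algebra_simps power2_eq_square)
  then have "torsion_quadric x = (r / k)^2 \<or> torsion_quadric x = - ((r / k)^2)"
    using k by (auto simp: field_simps)
  then show "\<exists>r. torsion_quadric x = r^2 \<or> torsion_quadric x = - (r^2)" ..
qed (use self_mem_cls square_up_to_sign_def in blast)

lemma torsion_quadric_eq_0_imp:
  assumes "torsion_quadric (a, b, c) = 0"
  shows "b = - a" "c = 0"
proof -
  \<comment> \<open>Completing the square: as a form in \<open>a + b\<close> and \<open>c\<close>
    the quadric has discriminant 17.\<close>
  have "(4 * (a + b) - c)^2 = 8 * torsion_quadric (a, b, c) + of_int 17 * c^2"
    by (simp add: algebra_simps power2_eq_square)
  then have "(4 * (a + b) - c)^2 = of_int 17 * c^2" using assms by simp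
  moreover have "prime (17 :: int)" by simp
  ultimately show "c = 0" using square_eq_prime_times_square_imp_0 by blast
  then show "b = - a" using assms by (simp add: add_eq_0_iff2)
qed

section \<open>The two involutions and their fixed points\<close>

lemma rational_points_cases:
  assumes "P \<in> rational_points"
  obtains a b c where "(a, b, c) \<noteq> zero3" "q a b c = 0" "P = cls (a, b, c)"
proof -
  obtain x where "x \<noteq> zero3" "cubic x = 0" "P = cls x" using assms by (rule rational_pointsE)
  then show ?thesis using that by (cases x) simp
qed

lemma third_point_O:
  assumes "(a, b, c) \<noteq> zero3" "q a b c = 0"
  shows "third_point (cls (a, b, c)) point_O = cls (b, a, c)"
proof (rule third_point_eqI)
  show "cls (a, b, c) \<in> rational_points" using assms by (simp add: cls_in_rational_points)
  have "cut_out_by_line {#cls (a, b, c), point_O, cls (b, a, c)#} \<and> cls (b, a, c) \<in> rational_points"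
  proof (cases "cls (a, b, c) = point_O")
    case True
    then have "cross O3 (a, b, c) = zero3"
      using assms(1) cls_eq_iff[of O3 "(a, b, c)"] by (simp add: point_cls)
    then have "cls (b, a, c) = point_O"
      using assms(1) by (simp add: point_cls cls_eq_iff)
    then show ?thesis using True cut_out_O_O point_O_rational by simp
  next
    case False
    then show ?thesis using cut_out_O[OF assms] by simp
  qed
  then show "cut_out_by_line {#cls (a, b, c), point_O, cls (b, a, c)#}" "cls (b, a, c) \<in> rational_points"
    by simp_all
qed simp

lemma third_point_A_A: "third_point point_A point_A = cls (1, 0, 1)"
  by (rule third_point_eqI[OF point_A_rational _ _ cut_out_A_A])
    (simp_all add: cls_in_rational_points q_def)

lemma third_point_A:
  assumes "(a, b, c) \<noteq> zero3" "q a b c = 0" "cls (a, b, c) \<noteq> point_A"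
  defines "\<beta> \<equiv> 2 * (a + c)^2 + b * (a + 3 * c)"
  shows "third_point (cls (a, b, c)) point_A = cls (a * b + \<beta>, b^2, b * c - \<beta>)"
    and "(a * b + \<beta>, b^2, b * c - \<beta>) \<noteq> zero3"
proof -
  note cut = cut_out_A[OF assms(1-3), folded \<beta>_def]
  show "third_point (cls (a, b, c)) point_A = cls (a * b + \<beta>, b^2, b * c - \<beta>)"
    using assms(1,2) by (intro third_point_eqI cut) (simp_all add: cls_in_rational_points)
  show "(a * b + \<beta>, b^2, b * c - \<beta>) \<noteq> zero3"
    using cut(2) unfolding cls_in_rational_points by blast
qed

text \<open>Completing the square in \<open>m^2\<close>, then in \<open>m\<close>, gives a sum of
  squares with positive coefficients.\<close>

lemma halving_quartic_pos:
  fixes m c :: rat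
  assumes "m \<noteq> 0"
  shows "5 * m^4 - 6 * m^3 * c - 2 * m^2 * c^2 + 8 * c^4 > 0"
proof (cases "c = 0")
  case False
  have "5 * m^4 - 6 * m^3 * c - 2 * m^2 * c^2 + 8 * c^4 =
      5 * (m^2 - 3/5 * m * c - 3/5 * c^2)^2 + c^2 * (11/5 * (m - 9/11 * c)^2 + 52/11 * c^2)"
    by (simp add: algebra_simps power2_eq_square power3_eq_cube power4_eq_xxxx)
  also have "\<dots> > 0"
    using False by (intro add_nonneg_pos mult_pos_pos) auto
  finally show ?thesis .
qed (use assms in simp)

text \<open>The tangents to the cubic through \<open>A\<close> with contact point other than \<open>A\<close> correspond to the
  roots of the quartic, so \<open>A\<close> is not even a double of a real point.\<close>

lemma third_point_A_neq:
  assumes "P \<in> rational_points"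
  shows "third_point P point_A \<noteq> P"
proof
  assume fixed: "third_point P point_A = P"
  obtain a b c where x: "(a, b, c) \<noteq> zero3" "q a b c = 0" and P: "P = cls (a, b, c)"
    using assms by (rule rational_points_cases)
  show False
  proof (cases "P = point_A")
    case True
    then show False using fixed third_point_A_A by (simp add: point_cls cls_eq_iff)
  next
    case False
    define m where "m = a + c"
    define n where "n = a + 3 * c"
    define \<beta> where "\<beta> = 2 * m^2 + b * n"
    have neq: "b \<noteq> 0 \<or> m \<noteq> 0"
      using False x(1) by (auto simp: P point_cls cls_eq_iff m_def add_eq_0_iff)
    note R = third_point_A[OF x False[unfolded P], folded m_def n_def, folded \<beta>_def]
    \<comment> \<open>This is \<open>\<beta>\<close> times the cross product of \<open>A3\<close>
      and \<open>(a, b, c)\<close>, whose entries are \<open>b\<close>, \<open>- m\<close>,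
      \<open>b\<close>.\<close>
    have "cross (a * b + \<beta>, b^2, b * c - \<beta>) (a, b, c) = zero3"
      using fixed R x(1) cls_eq_iff[of "(a * b + \<beta>, b^2, b * c - \<beta>)" "(a, b, c)"] P by simp
    then have "\<beta> * b = 0" "\<beta> * m = 0"
      by (simp_all add: m_def algebra_simps power2_eq_square)
    then have "\<beta> = 0" using neq by auto
    then have bn: "b * n = - 2 * m^2" by (simp add: \<beta>_def)
    have "n \<noteq> 0"
    proof
      assume "n = 0"
      then have "m = 0" using bn by simp
      then have "a = 0" "c = 0" using \<open>n = 0\<close> by (simp_all add: m_def n_def)
      then show False using x by (simp add: q_def)
    qed
    then have "m \<noteq> 0" using neq bn by auto
    \<comment> \<open>The factor \<open>n^3\<close> allows \<open>b * n\<close> to be replaced by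
      \<open>- 2 * m^2\<close>, which eliminates \<open>b\<close>.\<close>
    have "n^3 * q a b c = q (n * a) (b * n) (n * c)"
      by (simp add: q_def algebra_simps power2_eq_square power3_eq_cube)
    also have "\<dots> = - (m^2 * (5 * m^4 - 6 * m^3 * c - 2 * m^2 * c^2 + 8 * c^4))"
    proof -
      have a: "a = m - c" and n: "n = m + 2 * c" by (simp_all add: m_def n_def)
      show ?thesis unfolding bn unfolding a n
        by (simp add: q_def algebra_simps power2_eq_square power3_eq_cube power4_eq_xxxx)
    qed
    finally have "5 * m^4 - 6 * m^3 * c - 2 * m^2 * c^2 + 8 * c^4 = 0"
      using x(2) \<open>m \<noteq> 0\<close> by simp
    then show False using halving_quartic_pos[OF \<open>m \<noteq> 0\<close>, of c] by simp
  qed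
qed

text \<open>The swap of \<open>a\<close> and \<open>b\<close> fixes O and the points with
  \<open>a = b\<close>, which are the other 2-torsion points; the invariant excludes the rational
  one.\<close>

lemma third_point_O_fixed:
  assumes "P \<in> rational_points" "square_up_to_sign P" and fixed: "third_point P point_O = P"
  shows "P = point_O"
proof -
  obtain a b c where x: "(a, b, c) \<noteq> zero3" "q a b c = 0" and P: "P = cls (a, b, c)"
    using assms(1) by (rule rational_points_cases)
  have "cls (b, a, c) = cls (a, b, c)" using third_point_O[OF x] fixed P by simp
  then have cr: "c * (a - b) = 0" "(a - b) * (a + b) = 0"
    using x(1) by (auto simp: cls_eq_iff algebra_simps)
  obtain r where r: "torsion_quadric (a, b, c) = r^2 \<or> torsion_quadric (a, b, c) = - (r^2)"
    using assms(2) unfolding P square_up_to_sign_cls by blast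
  have "a \<noteq> b"
  proof
    assume b: "a = b"
    \<comment> \<open>The linear factor gives \<open>(1 : 1 : -1)\<close>, the quadric the two
      points that are conjugate over the rationals.\<close>
    have "q a b c = (a + c) * (torsion_quadric (a, b, c) / 2)"
      by (simp add: b q_def algebra_simps power2_eq_square power3_eq_cube)
    then consider "a + c = 0" | "torsion_quadric (a, b, c) = 0" using x(2) by auto
    then show False
    proof cases
      case 1
      then have c: "c = - a" by (simp add: add_eq_0_iff)
      \<comment> \<open>The value is positive and twice a nonzero square, so neither a square nor
        minus a square.\<close>
      have h8: "torsion_quadric (a, b, c) = 8 * a^2"
        by (simp add: b[symmetric] c algebra_simps power2_eq_square)
      have "a \<noteq> 0" using x(1) b c by auto
      then have "8 * a^2 > 0" by simp
      then have "8 * a^2 = r^2" using r h8 zero_le_power2[of r] by linarith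
      then have "r^2 = of_int 2 * (2 * a)^2" by (simp add: power_mult_distrib)
      moreover have "prime (2 :: int)" by simp
      ultimately have "2 * a = 0" using square_eq_prime_times_square_imp_0 by blast
      then show False using \<open>a \<noteq> 0\<close> by simp
    next
      case 2
      then have "a = 0" "b = 0" "c = 0" using torsion_quadric_eq_0_imp[OF 2] b by linarith+
      then show False using x(1) by simp
    qed
  qed
  then have "c = 0" "b = - a" using cr by (simp_all add: add_eq_0_iff)
  then show ?thesis using x(1) by (simp add: P point_cls cls_eq_iff)
qed

text \<open>The swap of \<open>a\<close> and \<open>b\<close> preserves \<open>a + b\<close> and
  \<open>c\<close>, hence the quadric.\<close>

lemma square_up_to_sign_third_point_O:
  assumes "P \<in> rational_points" "square_up_to_sign P"
  shows "square_up_to_sign (third_point P point_O)"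
proof -
  obtain a b c where x: "(a, b, c) \<noteq> zero3" "q a b c = 0" and P: "P = cls (a, b, c)"
    using assms(1) by (rule rational_points_cases)
  show ?thesis using assms(2) by (simp add: P third_point_O[OF x] square_up_to_sign_cls add.commute)
qed

text \<open>The values at \<open>P\<close> and at the third point of the chord through A multiply to
  minus a square, so the property passes on unless the value at \<open>P\<close> is 0, that is,
  \<open>P\<close> is O.\<close>

lemma square_up_to_sign_third_point_A:
  assumes "P \<in> rational_points" "square_up_to_sign P"
  shows "square_up_to_sign (third_point P point_A)"
proof (cases "P = point_A")
  case True
  have "torsion_quadric (1, 0, 1) = - (1^2)" by simp
  then show ?thesis unfolding True third_point_A_A square_up_to_sign_cls by blast
next
  case False
  obtain a b c where x: "(a, b, c) \<noteq> zero3" "q a b c = 0" and P: "P = cls (a, b, c)"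
    using assms(1) by (rule rational_points_cases)
  define \<beta> where "\<beta> = 2 * (a + c)^2 + b * (a + 3 * c)"
  define w where "w = ((a + c)^2 - (a + c) * b - 4 * b^2) * (a + b + c)"
  let ?R = "(a * b + \<beta>, b^2, b * c - \<beta>)"
  have R: "third_point P point_A = cls ?R"
    using third_point_A(1)[OF x] False by (simp add: P \<beta>_def)
  have "\<exists>r. torsion_quadric ?R = r^2 \<or> torsion_quadric ?R = - (r^2)"
  proof (cases "torsion_quadric (a, b, c) = 0")
    case True
    \<comment> \<open>Here \<open>P\<close> is O and the third point is \<open>(0 : 1 : -1)\<close>,
      the inverse of A.\<close>
    then have "b = - a" "c = 0" by (rule torsion_quadric_eq_0_imp)+
    then have "torsion_quadric ?R = (a^2)^2"
      by (simp add: \<beta>_def power2_eq_square)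
    then show ?thesis by blast
  next
    case False
    obtain r where r: "torsion_quadric (a, b, c) = r^2 \<or> torsion_quadric (a, b, c) = - (r^2)"
      using assms(2) unfolding P square_up_to_sign_cls by blast
    \<comment> \<open>Up to constants \<open>w\<close> is the product of the values of the linear form through \<open>P\<close> and \<open>A\<close> at the
      points of contact of \<open>torsion_quadric\<close> with the cubic; the cofactor of \<open>q\<close> comes from division
      with remainder in \<open>c\<close>.\<close>
    have "torsion_quadric (a, b, c) * torsion_quadric ?R + w^2 = q a b c *
        (7 * c^3 + 23 * a * c^2 + 33 * b * c^2 + 25 * a^2 * c + 69 * a * b * c + 46 * b^2 * c
          + 9 * a^3 + 35 * a^2 * b + 46 * a * b^2 + 20 * b^3)"
      unfolding w_def \<beta>_def q_def torsion_quadric.simps by algebra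
    then have "torsion_quadric (a, b, c) * torsion_quadric ?R = - (w^2)" using x(2) by simp
    then have "torsion_quadric ?R = - (w^2) / torsion_quadric (a, b, c)" using False by (simp add: field_simps)
    then have "torsion_quadric ?R = - ((w / r)^2) \<or> torsion_quadric ?R = (w / r)^2"
      using r by (auto simp: power_divide)
    then show ?thesis by blast
  qed
  then show ?thesis unfolding R square_up_to_sign_cls .
qed

text \<open>For the map \<open>T = i \<circ> j\<close> this is \<open>T\<^sup>-\<^sup>1 = i \<circ> T \<circ> i\<close>, applied at a fixed point of \<open>i\<close>.\<close>

lemma involution_orbit:
  fixes p :: "nat \<Rightarrow> 'a"
  assumes closed: "\<And>x. x \<in> S \<Longrightarrow> i x \<in> S" "\<And>x. x \<in> S \<Longrightarrow> j x \<in> S"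
    and inv: "\<And>x. x \<in> S \<Longrightarrow> i (i x) = x" "\<And>x. x \<in> S \<Longrightarrow> j (j x) = x"
    and p: "\<And>n. p n \<in> S" "i (p 0) = p 0" "\<And>n. p (Suc n) = i (j (p n))"
    and n: "p n = p 0" "k \<le> n"
  shows "p (n - k) = i (p k)"
  using n(2)
proof (induction k)
  case (Suc k)
  \<comment> \<open>As \<open>n - k\<close> is \<open>Suc (n - Suc k)\<close>, this rewrites the
    induction hypothesis. Cancelling \<open>i\<close> and applying \<open>j\<close> then yields the
    claim for \<open>Suc k\<close>.\<close>
  then have "i (p k) = i (j (p (n - Suc k)))"
    using p(3)[of "n - Suc k"] by (simp add: Suc_diff_Suc)
  then have "p k = j (p (n - Suc k))" using inv(1) closed(2) p(1) by metis
  then show ?case using inv closed p(1,3) by metis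
qed (use n p in simp)

section \<open>The orbit of O under translation by A\<close>

definition multiple_of_A :: "nat \<Rightarrow> triple set" where
  "multiple_of_A n = point_A [^]\<^bsub>mordell_weil\<^esub> n"

lemma multiple_of_A_0: "multiple_of_A 0 = point_O"
  by (simp add: multiple_of_A_def nat_pow_def mordell_weil_def)

lemma multiple_of_A_Suc:
  "multiple_of_A (Suc n) = third_point (third_point (multiple_of_A n) point_A) point_O"
  by (simp add: multiple_of_A_def nat_pow_def mordell_weil_def)

lemma multiple_of_A_invariant: "multiple_of_A n \<in> rational_points \<and> square_up_to_sign (multiple_of_A n)"
proof (induction n)
  case 0
  \<comment> \<open>Zero counts as a square, so that O has the property.\<close>
  have "torsion_quadric O3 = 0^2" by simp
  then have "square_up_to_sign point_O" unfolding point_cls square_up_to_sign_cls by blast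
  then show ?case by (simp add: multiple_of_A_0 point_O_rational)
next
  case (Suc n)
  then show ?case
    by (simp add: multiple_of_A_Suc third_point_props square_up_to_sign_third_point_A square_up_to_sign_third_point_O)
qed

lemma multiple_of_A_neq_O: "n > 0 \<Longrightarrow> multiple_of_A n \<noteq> point_O"
proof (induction n rule: less_induct)
  case (less n)
  show ?case
  proof
    assume n: "multiple_of_A n = point_O"
    have "third_point point_O point_O = point_O"
      by (rule third_point_eqI[OF point_O_rational point_O_rational _ cut_out_O_O]) simp
    then have refl: "multiple_of_A (n - k) = third_point (multiple_of_A k) point_O" if "k \<le> n" for k
      using n that
      by (intro involution_orbit[where S = rational_points and p = multiple_of_A
            and i = "\<lambda>P. third_point P point_O" and j = "\<lambda>P. third_point P point_A"])
        (simp_all add: third_point_props multiple_of_A_0 multiple_of_A_Suc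
          conjunct1[OF multiple_of_A_invariant])
    show False
    proof (cases "even n")
      case True
      then obtain k where k: "n = 2 * k" by blast
      then have "third_point (multiple_of_A k) point_O = multiple_of_A k" using refl[of k] by simp
      then have "multiple_of_A k = point_O"
        using third_point_O_fixed multiple_of_A_invariant by blast
      \<comment> \<open>Descent: \<open>k\<close> is positive and smaller than
        \<open>n\<close>.\<close>
      then show False using less k by auto
    next
      case False
      then obtain k where k: "n = Suc (2 * k)" by (auto elim: oddE)
      \<comment> \<open>Here \<open>n - k\<close> is \<open>Suc k\<close>; both sides are images
        under the involution of O, which is cancelled next.\<close>
      then have "multiple_of_A (Suc k) = third_point (multiple_of_A k) point_O"
        using refl[of k] by (simp add: Suc_diff_le)
      then have "third_point (multiple_of_A k) point_A = multiple_of_A k"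
        unfolding multiple_of_A_Suc
        using third_point_props multiple_of_A_invariant by (metis insertCI)
      then show False using third_point_A_neq multiple_of_A_invariant by blast
    qed
  qed
qed

text \<open>Translation by A is a composition of involutions, hence injective, so an equality of two
  multiples can be shifted down to O.\<close>

lemma inj_multiple_of_A: "inj multiple_of_A"
proof (rule linorder_injI)
  have cancel: "multiple_of_A (m + d) \<noteq> multiple_of_A m" if "d > 0" for m d
  proof (induction m)
    case 0
    then show ?case using multiple_of_A_neq_O[OF that] by (simp add: multiple_of_A_0)
  next
    case (Suc m)
    then show ?case
      using third_point_props multiple_of_A_invariant unfolding multiple_of_A_Suc add_Suc
      by (metis insertCI)
  qed
  show "multiple_of_A m \<noteq> multiple_of_A n" if "m < n" for m n
    using cancel[of "n - m" m] that by simp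
qed

theorem proposition4p5:
  shows "infinite rational_points
    \<and> point_A \<in> carrier mordell_weil
    \<and> (\<forall>n::nat. n > 0 \<longrightarrow> point_A [^]\<^bsub>mordell_weil\<^esub> n \<noteq> \<one>\<^bsub>mordell_weil\<^esub>)"
proof (intro conjI)
  have "range multiple_of_A \<subseteq> rational_points" using multiple_of_A_invariant by blast
  then show "infinite rational_points"
    using range_inj_infinite[OF inj_multiple_of_A] finite_subset by blast
  show "point_A \<in> carrier mordell_weil"
    by (simp add: mordell_weil_def point_A_rational)
  show "\<forall>n::nat. n > 0 \<longrightarrow> point_A [^]\<^bsub>mordell_weil\<^esub> n \<noteq> \<one>\<^bsub>mordell_weil\<^esub>"
    using multiple_of_A_neq_O by (simp add: multiple_of_A_def mordell_weil_def)
qed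

end
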